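(* Let $n\geq 8$ and $a$ be integers with $2\leq a<\frac{n}{2}$ and $(n,a)\neq(8,3)$, and let $\overline{\Gamma}=\overline{C_n(1,a)}$ be the complement of the circulant graph $C_n(1,a)$. Then its vertex-forwarding index is $$\xi(\overline{\Gamma})=4.$$
   Context: For $S\subseteq\mathbb{Z}_n\setminus\{0\}$, the circulant graph $C_n(S)$ is the simple undirected graph with vertex set $\mathbb{Z}_n=\{0,1,\ldots,n-1\}$ and edge set $\{\{g,g+s\}: g\in\mathbb{Z}_n, s\in S\}$ (addition mod $n$); $C_n(1,a)$ means $C_n(\{1,a\})$. $\overline{\Gamma}$ denotes the complement of $\Gamma$. A routing $R$ of a connected graph $\Gamma$ on $n$ vertices is a set of $n(n-1)$ elementary (i.e. simple) paths $R(x,y)$, one from $x$ to $y$ for every ordered pair $(x,y)$ of distinct vertices. The load $\xi_x(\Gamma,R)$ of a vertex $x$ is the number of paths of $R$ having $x$ as an inner (non-end) vertex. Put $\xi(\Gamma,R)=\max_{x\in V(\Gamma)}\xi_x(\Gamma,R)$. The vertex-forwarding index is $\xi(\Gamma)=\min_R \xi(\Gamma,R)$, the minimum over all routings $R$ of $\Gamma$. *)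

theory Defs
  imports "Graph_Theory.Graph_Theory"
begin

text \<open>
  As in the AFP entry Graph_Theory, simple undirected graphs are symmetric
  loop-free digraphs (\<^locale>\<open>pair_graph\<close>): the edge {u,v} is represented by the two
  arcs (u,v) and (v,u).
\<close>

text \<open>
  The residues modulo n are represented by 0, ..., n - 1. The connection set S is
  meant to satisfy S \<subseteq> {1..<n}; a residue 0 in S would produce loops.
\<close>

definition circulant :: "int \<Rightarrow> int set \<Rightarrow> int pair_pre_digraph" where
  "circulant n S =
    \<lparr> pverts = {0..<n},
      parcs = {(u, v). \<exists>g\<in>{0..<n}. \<exists>s\<in>S. {u, v} = {g, (g + s) mod n}} \<rparr>"

definition complement :: "'a pair_pre_digraph \<Rightarrow> 'a pair_pre_digraph" where
  "complement G =
    \<lparr> pverts = pverts G,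
      parcs = {(u, v). u \<in> pverts G \<and> v \<in> pverts G \<and> u \<noteq> v \<and> (u, v) \<notin> parcs G} \<rparr>"

text \<open>
  Paths are given by their vertex sequences, and are directed from the first to the
  last vertex. R(x,y) is the unique member of R from x to y.
\<close>

definition routing :: "'a pair_pre_digraph \<Rightarrow> 'a list set \<Rightarrow> bool" where
  "routing G R \<longleftrightarrow>
    (\<forall>p\<in>R. vpath p (with_proj G) \<and> hd p \<noteq> last p) \<and>
    (\<forall>x\<in>pverts G. \<forall>y\<in>pverts G. x \<noteq> y \<longrightarrow> (\<exists>!p. p \<in> R \<and> hd p = x \<and> last p = y))"

definition inner_verts :: "'a list \<Rightarrow> 'a set" where
  "inner_verts p = set (butlast (tl p))"

definition vertex_load :: "'a list set \<Rightarrow> 'a \<Rightarrow> nat" where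
  "vertex_load R x = card {p \<in> R. x \<in> inner_verts p}"

definition max_load :: "'a pair_pre_digraph \<Rightarrow> 'a list set \<Rightarrow> nat" where
  "max_load G R = Max (vertex_load R ` pverts G)"

text \<open>
  The infimum is over a set of natural numbers, so it is a minimum whenever a routing
  exists, i.e. whenever G is connected. For disconnected G the value is the dummy 0.
\<close>

definition vertex_forwarding_index :: "'a pair_pre_digraph \<Rightarrow> nat" where
  "vertex_forwarding_index G = (INF R\<in>{R. routing G R}. max_load G R)"

lemma pair_graph_circulant:
  assumes "S \<subseteq> {1..<n}"
  shows "pair_graph (circulant n S)"
proof -
  let ?G = "circulant n S"
  have verts: "u \<in> {0..<n} \<and> v \<in> {0..<n}" if "(u, v) \<in> parcs ?G" for u v
    using that by (auto simp: circulant_def doubleton_eq_iff)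
  have neq: "u \<noteq> v" if "(u, v) \<in> parcs ?G" for u v
  proof
    assume "u = v"
    with that obtain g s where gs: "g \<in> {0..<n}" "s \<in> S" "g = (g + s) mod n"
      by (auto simp: circulant_def doubleton_eq_iff)
    then have "n dvd s"
      by (metis add_diff_cancel_left' mod_eq_dvd_iff mod_mod_trivial)
    with gs(2) assms show False
      using zdvd_not_zless[of s n] by auto
  qed
  have "parcs ?G \<subseteq> {0..<n} \<times> {0..<n}"
    using verts by auto
  then have "finite (parcs ?G)"
    by (rule finite_subset) auto
  moreover have "sym (parcs ?G)"
    by (auto simp: sym_def circulant_def insert_commute)
  moreover have "pverts ?G = {0..<n}"
    by (simp add: circulant_def)
  ultimately show ?thesis
    using verts neq by unfold_locales (auto simp: symmetric_def)
qed

lemma pair_graph_complement: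
  assumes "pair_graph G"
  shows "pair_graph (complement G)"
proof -
  interpret pair_graph G by fact
  have "sym (parcs G)"
    using pair_sym_arcs by (simp add: symmetric_def)
  moreover have "finite (parcs (complement G))"
    by (rule finite_subset[of _ "pverts G \<times> pverts G"]) (auto simp: complement_def)
  ultimately show ?thesis
    using pair_finite_verts
    by unfold_locales (auto simp: complement_def symmetric_def sym_def)
qed

end

theory Submission
  imports Defs
begin

text \<open>
  Write \<open>D = {1, a, -1, -a}\<close> for the set of differences of \<open>C\<^sub>n(1,a)\<close> modulo \<open>n\<close>; it has four
  elements because \<open>2 \<le> a < n/2\<close>. In the complement \<open>G\<close>, the ordered pairs that are not joined by
  an edge are the pairs \<open>(x, x + d)\<close> with \<open>d \<in> D\<close>, so there are \<open>4n\<close> of them.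

  The index is at least 4 by double counting (\<open>max_load_lower_bound\<close>): a path between
  non-adjacent vertices has an inner vertex, so the \<open>n\<close> vertices carry a total load of at
  least \<open>4n\<close>, in any routing.

  The index is at most 4 because the non-adjacent pairs can be served by paths of length two
  that respect the rotations. Suppose that each \<open>d \<in> D\<close> is a sum \<open>d = s + t\<close>, where \<open>s\<close> and \<open>t\<close>
  lie outside \<open>D \<union> {0}\<close>, and fix one such \<open>s = h d\<close>. Then \<open>x, x + h d, x + d\<close> is a path in \<open>G\<close>, and
  a vertex \<open>z\<close> is the midpoint of exactly one such path for each \<open>d\<close>, namely that with
  \<open>x = z - h d\<close>. So every vertex has load 4, and each adjacent pair takes its edge, which loads
  nothing. Both halves hold for any connection set and give the index \<open>|D|\<close>
  (\<open>vertex_forwarding_index_complement_circulant\<close>).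

  The required \<open>s\<close> must avoid \<open>D \<union> {0}\<close> and its reflection \<open>d - (D \<union> {0})\<close>. Both contain
  0 and \<open>d\<close>, so together they have at most \<open>2|D| = 8\<close> elements, and for \<open>n > 8\<close> some residue is
  left over (\<open>split_difference\<close>). For \<open>n = 8\<close> only \<open>a = 2\<close> remains, where \<open>s\<close> is written down. The
  pair \<open>(8,3)\<close> is a real exception: there \<open>D\<close> is the set of all odd residues and the complement is
  disconnected.
\<close>

section \<open>The load forced by the non-adjacent pairs\<close>

text \<open>
  A path of a routing is determined by its two ends, so there are at most as many paths as
  pairs of vertices. Finiteness is what keeps the cardinalities that define loads from
  collapsing to 0.
\<close>

lemma routing_finite:
  assumes "finite (pverts G)" "routing G R"
  shows "finite R"
proof -
  have ends: "hd p \<in> pverts G \<and> last p \<in> pverts G \<and> hd p \<noteq> last p" if "p \<in> R" for p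
  proof -
    have "set p \<subseteq> pverts G" "p \<noteq> []" "hd p \<noteq> last p"
      using that assms(2) by (auto simp: routing_def vpath_def vwalk_def)
    then show ?thesis by auto
  qed
  have "inj_on (\<lambda>p. (hd p, last p)) R"
  proof (rule inj_onI)
    fix p q assume pq: "p \<in> R" "q \<in> R" "(hd p, last p) = (hd q, last q)"
    then have "\<exists>!r. r \<in> R \<and> hd r = hd p \<and> last r = last p"
      using ends[of p] assms(2) by (auto simp: routing_def)
    with pq show "p = q" by auto
  qed
  moreover have "(\<lambda>p. (hd p, last p)) ` R \<subseteq> pverts G \<times> pverts G"
    using ends by auto
  ultimately show ?thesis
    using assms(1) by (meson finite_SigmaI finite_subset inj_on_finite)
qed

lemma inner_vertex_of_nonadjacent_path:
  assumes "vpath p (with_proj G)" "hd p \<noteq> last p" "(hd p, last p) \<notin> parcs G"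
  obtains z where "z \<in> pverts G" "z \<in> inner_verts p"
proof -
  from assms(1,2) obtain x q where p: "p = x # q" and q: "q \<noteq> []"
    by (cases p) (auto simp: vpath_def vwalk_def split: if_splits)
  then obtain y r where q': "q = r @ [y]"
    by (metis append_butlast_last_id)
  have "r \<noteq> []"
    using assms p q' by (auto simp: vpath_def vwalk_def)
  then have "hd r \<in> inner_verts p" "hd r \<in> set p"
    using p q' by (auto simp: inner_verts_def)
  then show thesis
    using that assms(1) by (auto simp: vpath_def vwalk_def)
qed

text \<open>
  Count the incidences \<open>(z, p)\<close> of a path \<open>p\<close> with an inner vertex \<open>z\<close>. Summed over \<open>z\<close> they
  give the total load; sending \<open>(z, p)\<close> to the ends of \<open>p\<close> reaches every ordered pair of
  distinct non-adjacent vertices. These pairs are the arcs of the complement.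
\<close>

lemma max_load_lower_bound:
  assumes "finite (pverts G)" "routing G R"
  shows "card (parcs (complement G)) \<le> card (pverts G) * max_load G R"
proof -
  let ?I = "SIGMA z:pverts G. {p \<in> R. z \<in> inner_verts p}"
  have fin: "finite R"
    using assms by (rule routing_finite)
  have "parcs (complement G) \<subseteq> (\<lambda>(z, p). (hd p, last p)) ` ?I"
  proof safe
    fix x y assume "(x, y) \<in> parcs (complement G)"
    then have xy: "x \<in> pverts G" "y \<in> pverts G" "x \<noteq> y" "(x, y) \<notin> parcs G"
      by (auto simp: complement_def)
    with assms(2) obtain p where p: "p \<in> R" "hd p = x" "last p = y"
      unfolding routing_def by blast
    with assms(2) have "vpath p (with_proj G)"
      by (auto simp: routing_def)
    with p xy obtain z where "z \<in> pverts G" "z \<in> inner_verts p"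
      using inner_vertex_of_nonadjacent_path by metis
    with p show "(x, y) \<in> (\<lambda>(z, p). (hd p, last p)) ` ?I"
      by (intro image_eqI[of _ _ "(z, p)"]) auto
  qed
  then have "card (parcs (complement G)) \<le> card ?I"
    using assms(1) fin by (intro surj_card_le) auto
  also have "\<dots> = (\<Sum>z\<in>pverts G. vertex_load R z)"
    using assms(1) fin by (simp add: vertex_load_def)
  also have "\<dots> \<le> card (pverts G) * max_load G R"
    using assms(1) sum_bounded_above[of "pverts G" "vertex_load R" "max_load G R"]
    by (simp add: max_load_def)
  finally show ?thesis .
qed

section \<open>Routing non-adjacent pairs through one midpoint\<close>

definition midpoint_path :: "'a pair_pre_digraph \<Rightarrow> ('a \<times> 'a \<Rightarrow> 'a) \<Rightarrow> 'a \<times> 'a \<Rightarrow> 'a list" where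
  "midpoint_path G m e = (if e \<in> parcs G then [fst e, snd e] else [fst e, m e, snd e])"

definition midpoint_routing :: "'a pair_pre_digraph \<Rightarrow> ('a \<times> 'a \<Rightarrow> 'a) \<Rightarrow> 'a list set" where
  "midpoint_routing G m =
    midpoint_path G m ` {(x, y). x \<in> pverts G \<and> y \<in> pverts G \<and> x \<noteq> y}"

lemma routing_midpoint_routing:
  assumes "pair_graph G"
    and m: "\<And>x y. (x, y) \<in> parcs (complement G) \<Longrightarrow>
      (x, m (x, y)) \<in> parcs G \<and> (m (x, y), y) \<in> parcs G"
  shows "routing G (midpoint_routing G m)"
proof -
  interpret pair_graph G by fact
  have ends: "hd (midpoint_path G m e) = fst e" "last (midpoint_path G m e) = snd e" for e
    by (auto simp: midpoint_path_def)
  have path: "vpath (midpoint_path G m (x, y)) (with_proj G)"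
    if xy: "x \<in> pverts G" "y \<in> pverts G" "x \<noteq> y" for x y
  proof (cases "(x, y) \<in> parcs G")
    case True
    with xy show ?thesis by (auto simp: midpoint_path_def vpath_def vwalk_def)
  next
    case False
    with xy m[of x y] have 1: "(x, m (x, y)) \<in> parcs G" "(m (x, y), y) \<in> parcs G"
      by (auto simp: complement_def)
    moreover from 1 have "m (x, y) \<noteq> x" "m (x, y) \<noteq> y" "m (x, y) \<in> pverts G"
      using pair_no_loops[of "(x, m (x, y))"] pair_no_loops[of "(m (x, y), y)"] in_arcsD2[of x]
      by auto
    ultimately show ?thesis
      using xy False by (auto simp: midpoint_path_def vpath_def vwalk_def)
  qed
  show ?thesis
    unfolding routing_def
  proof (intro conjI ballI impI)
    fix x y assume "x \<in> pverts G" "y \<in> pverts G" "x \<noteq> y"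
    then show "\<exists>!p. p \<in> midpoint_routing G m \<and> hd p = x \<and> last p = y"
      by (intro ex1I[of _ "midpoint_path G m (x, y)"])
        (auto simp: midpoint_routing_def ends)
  qed (use path in \<open>auto simp: midpoint_routing_def ends\<close>)
qed

text \<open>Direct arcs have no inner vertex, so only the pairs that are sent through \<open>z\<close> count.\<close>

lemma vertex_load_midpoint_routing:
  assumes "finite (pverts G)"
  shows "vertex_load (midpoint_routing G m) z \<le> card {e \<in> parcs (complement G). m e = z}"
proof -
  have "finite (parcs (complement G))"
    by (rule finite_subset[of _ "pverts G \<times> pverts G"]) (use assms in \<open>auto simp: complement_def\<close>)
  moreover have "{p \<in> midpoint_routing G m. z \<in> inner_verts p} \<subseteq>
      midpoint_path G m ` {e \<in> parcs (complement G). m e = z}"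
    by (auto simp: midpoint_routing_def midpoint_path_def inner_verts_def complement_def
        split: if_splits)
  ultimately show ?thesis
    unfolding vertex_load_def by (intro surj_card_le) auto
qed

section \<open>Complements of circulant graphs\<close>

text \<open>
  The connection set made symmetric and reduced modulo \<open>n\<close>, so that adjacency can be read off
  from \<open>(v - u) mod n\<close> alone.
\<close>

definition circulant_differences :: "int \<Rightarrow> int set \<Rightarrow> int set" where
  "circulant_differences n S = (\<lambda>s. s mod n) ` (S \<union> uminus ` S)"

lemma diff_mod_eq_iff:
  fixes n u v s :: int
  assumes "u \<in> {0..<n}" "v \<in> {0..<n}"
  shows "(v - u) mod n = s mod n \<longleftrightarrow> v = (u + s) mod n"
proof -
  have "(v - u) mod n = s mod n \<longleftrightarrow> v mod n = (u + s) mod n"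
    by (simp add: mod_eq_dvd_iff algebra_simps)
  with assms show ?thesis by simp
qed

lemma parcs_circulant:
  assumes "n > 0"
  shows "parcs (circulant n S) =
    {(u, v). u \<in> {0..<n} \<and> v \<in> {0..<n} \<and> (v - u) mod n \<in> circulant_differences n S}"
    (is "?A = ?B")
proof (intro set_eqI iffI; clarify)
  fix u v assume "(u, v) \<in> ?A"
  then obtain g s where gs: "g \<in> {0..<n}" "s \<in> S" "{u, v} = {g, (g + s) mod n}"
    by (auto simp: circulant_def)
  then have uv: "u \<in> {0..<n}" "v \<in> {0..<n}"
    using assms by (auto simp: doubleton_eq_iff)
  from gs(3) have "v = (u + s) mod n \<or> u = (v + s) mod n"
    by (auto simp: doubleton_eq_iff)
  then have "(v - u) mod n = s mod n \<or> (v - u) mod n = (- s) mod n"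
    using uv diff_mod_eq_iff[of u n v s] diff_mod_eq_iff[of v n u s]
    by (metis minus_diff_eq mod_minus_eq)
  with gs(2) uv show "u \<in> {0..<n} \<and> v \<in> {0..<n} \<and> (v - u) mod n \<in> circulant_differences n S"
    by (auto simp: circulant_differences_def)
next
  fix u v assume uv: "u \<in> {0..<n}" "v \<in> {0..<n}"
    and "(v - u) mod n \<in> circulant_differences n S"
  then obtain s where s: "s \<in> S" "(v - u) mod n = s mod n \<or> (v - u) mod n = (- s) mod n"
    by (auto simp: circulant_differences_def)
  then have "v = (u + s) mod n \<or> u = (v + s) mod n"
    using uv diff_mod_eq_iff[of u n v s] diff_mod_eq_iff[of v n u s]
    by (metis minus_diff_eq minus_minus mod_minus_eq)
  with uv s(1) show "(u, v) \<in> ?A"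
    by (auto simp: circulant_def doubleton_eq_iff)
qed

lemma circulant_differences_subset:
  assumes "S \<subseteq> {1..<n}"
  shows "circulant_differences n S \<subseteq> {1..<n}"
proof -
  have "s mod n \<in> {1..<n} \<and> (- s) mod n \<in> {1..<n}" if "s \<in> S" for s
  proof -
    have "s \<in> {1..<n}" using assms that by auto
    then show ?thesis by (auto simp: zmod_zminus1_eq_if)
  qed
  then show ?thesis
    by (auto simp: circulant_differences_def)
qed

lemma card_parcs_circulant:
  assumes "n > 0"
  shows "card (parcs (circulant n S)) = nat n * card (circulant_differences n S)"
proof -
  let ?D = "circulant_differences n S"
  have D: "d mod n = d" if "d \<in> ?D" for d
    using that by (auto simp: circulant_differences_def)
  have "bij_betw (\<lambda>(u, v). (u, (v - u) mod n)) (parcs (circulant n S)) ({0..<n} \<times> ?D)"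
    by (rule bij_betw_byWitness[where f' = "\<lambda>(u, d). (u, (u + d) mod n)"])
      (use assms D in \<open>auto simp: parcs_circulant mod_simps\<close>)
  from bij_betw_same_card[OF this] show ?thesis
    by (simp add: card_cartesian_product)
qed

lemma complement_complement:
  assumes "pair_graph G"
  shows "parcs (complement (complement G)) = parcs G"
proof -
  interpret pair_graph G by fact
  have "u \<in> pverts G \<and> v \<in> pverts G \<and> u \<noteq> v" if "(u, v) \<in> parcs G" for u v
    using that pair_no_loops[of "(u, v)"] in_arcsD1[of u v] in_arcsD2[of u v] by simp
  then show ?thesis
    by (auto simp: complement_def)
qed

text \<open>
  The lower bound is the number of differences because each vertex has that many non-neighbours.
  The split condition says that any two non-adjacent vertices have a common neighbour;
  choosing it by the difference alone makes the load the same at all vertices, so the lower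
  bound is attained.
\<close>

theorem vertex_forwarding_index_complement_circulant:
  assumes n: "n > 0" and S: "S \<subseteq> {1..<n}"
    and split: "\<And>d. d \<in> circulant_differences n S \<Longrightarrow>
      \<exists>s\<in>{0..<n} - insert 0 (circulant_differences n S).
        (d - s) mod n \<notin> insert 0 (circulant_differences n S)"
  shows "vertex_forwarding_index (complement (circulant n S)) =
    card (circulant_differences n S)"
proof -
  let ?D = "circulant_differences n S"
  let ?C = "circulant n S"
  let ?G = "complement ?C"
  have verts: "pverts ?G = {0..<n}"
    by (simp add: complement_def circulant_def)
  have C: "pair_graph ?C" and G: "pair_graph ?G"
    using S by (simp_all add: pair_graph_circulant pair_graph_complement)
  have nonadj: "parcs (complement ?G) = parcs ?C"
    using C by (rule complement_complement)
  have finD: "finite ?D"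
    using circulant_differences_subset[OF S] by (rule finite_subset) simp
  have adj: "(u, v) \<in> parcs ?G"
    if "u \<in> {0..<n}" "v \<in> {0..<n}" "(v - u) mod n \<notin> insert 0 ?D" for u v
    using that n parcs_circulant[OF n, of S]
    by (auto simp: complement_def circulant_def[of n S])
  obtain h where h: "\<And>d. d \<in> ?D \<Longrightarrow> h d \<in> {0..<n} \<and> h d \<notin> insert 0 ?D \<and>
      (d - h d) mod n \<notin> insert 0 ?D"
    using split by (metis DiffE)
  define m where "m = (\<lambda>(x, y). (x + h ((y - x) mod n)) mod n)"
  let ?R = "midpoint_routing ?G m"
  have R: "routing ?G ?R"
  proof (rule routing_midpoint_routing[OF G])
    fix x y assume "(x, y) \<in> parcs (complement ?G)"
    then have xy: "x \<in> {0..<n}" "y \<in> {0..<n}" "(y - x) mod n \<in> ?D"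
      using parcs_circulant[OF n] by (auto simp: nonadj)
    have "(m (x, y) - x) mod n = h ((y - x) mod n)"
      using h[OF xy(3)] by (simp add: m_def mod_simps)
    moreover have "(y - m (x, y)) mod n = ((y - x) mod n - h ((y - x) mod n)) mod n"
      by (simp add: m_def mod_simps algebra_simps)
    moreover have "m (x, y) \<in> {0..<n}"
      using n by (simp add: m_def)
    ultimately show "(x, m (x, y)) \<in> parcs ?G \<and> (m (x, y), y) \<in> parcs ?G"
      using h[OF xy(3)] xy by (intro conjI adj) simp_all
  qed
  have load: "vertex_load ?R z \<le> card ?D" for z
  proof -
    \<comment> \<open>A difference and the midpoint \<open>z\<close> determine the start of the path, hence also its end.\<close>
    have "inj_on (\<lambda>(x, y). (y - x) mod n) {e \<in> parcs ?C. m e = z}"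
    proof (rule inj_onI, clarify)
      fix x y x' y'
      assume e: "(x, y) \<in> parcs ?C" "(x', y') \<in> parcs ?C"
        and d: "(y - x) mod n = (y' - x') mod n" and mm: "m (x', y') = m (x, y)"
      have V: "x \<in> {0..<n}" "y \<in> {0..<n}" "x' \<in> {0..<n}" "y' \<in> {0..<n}"
        using e parcs_circulant[OF n] by auto
      have "x mod n = x' mod n"
        using mm d by (simp add: m_def mod_eq_dvd_iff) (metis dvd_minus_iff minus_diff_eq)
      then have "x = x'" using V by simp
      moreover from this d have "y mod n = y' mod n"
        by (simp add: mod_eq_dvd_iff)
      ultimately show "x = x' \<and> y = y'" using V by simp
    qed
    moreover have "(\<lambda>(x, y). (y - x) mod n) ` {e \<in> parcs ?C. m e = z} \<subseteq> ?D"
      using parcs_circulant[OF n] by auto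
    ultimately have "card {e \<in> parcs ?C. m e = z} \<le> card ?D"
      using finD by (rule card_inj_on_le)
    with vertex_load_midpoint_routing[of ?G m z] show ?thesis
      by (simp add: verts nonadj)
  qed
  have "max_load ?G ?R \<le> card ?D"
    using load n by (auto simp: max_load_def verts)
  moreover have "card ?D \<le> max_load ?G R" if "routing ?G R" for R
    using max_load_lower_bound[OF _ that] n
    by (simp add: verts nonadj card_parcs_circulant)
  ultimately show ?thesis
    unfolding vertex_forwarding_index_def using R
    by (intro cInf_eq_minimum) (auto intro!: image_eqI[of _ _ ?R] simp: le_antisym)
qed

text \<open>
  Pigeonhole: \<open>s\<close> has to avoid \<open>D \<union> {0}\<close> and the image of this set under the reflection
  \<open>e \<mapsto> d - e\<close>. The reflection exchanges 0 and \<open>d\<close>, so the two sets share at least two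
  elements and their union has at most \<open>2 * card D\<close>.
\<close>

lemma split_difference:
  fixes n d :: int
  assumes D: "D \<subseteq> {1..<n}" and card: "2 * card D < nat n" and d: "d \<in> D"
  shows "\<exists>s\<in>{0..<n} - insert 0 D. (d - s) mod n \<notin> insert 0 D"
proof -
  let ?E = "insert 0 D"
  let ?F = "(\<lambda>e. (d - e) mod n) ` ?E"
  have fin: "finite D"
    using D by (rule finite_subset) simp
  have E: "card ?E = Suc (card D)"
    using D fin by (subst card_insert_disjoint) auto
  have F: "card ?F \<le> Suc (card D)"
    using card_image_le[of ?E] fin E by (metis finite_insert)
  have d': "d \<noteq> 0" "d mod n = d"
    using D d by auto
  then have "{0, d} \<subseteq> ?E \<inter> ?F"
    using d by (auto intro: image_eqI[of _ _ d] image_eqI[of _ _ 0])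
  then have "card {0, d} \<le> card (?E \<inter> ?F)"
    using fin by (intro card_mono) auto
  with d' have "2 \<le> card (?E \<inter> ?F)" by simp
  then have "card (?E \<union> ?F) < card {0..<n}"
    using card_Un_Int[of ?E ?F] fin E F card by simp
  then obtain s where s: "s \<in> {0..<n}" "s \<notin> ?E" "s \<notin> ?F"
    by (metis UnCI card_mono finite_UnI finite_imageI finite_insert fin leD subsetI)
  \<comment> \<open>The reflection is an involution, so \<open>s\<close> is not in the image exactly when its own
    reflection is not in \<open>D \<union> {0}\<close>.\<close>
  have "(d - (d - s) mod n) mod n = s"
    using s(1) by (simp add: mod_simps)
  then have "(d - s) mod n \<notin> ?E"
    using s(3) by (metis imageI)
  with s show ?thesis by blast
qed

section \<open>The connection set with two elements\<close>

lemma circulant_differences_pair: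
  fixes n a :: int
  assumes "2 \<le> a" "2 * a < n"
  shows "circulant_differences n {1, a} = {1, a, n - 1, n - a}"
  using assms by (auto simp: circulant_differences_def zmod_zminus1_eq_if)

theorem corollary4p7:
  fixes n a :: int
  assumes "n \<ge> 8"
    and "2 \<le> a"
    and "real_of_int a < real_of_int n / 2"
    and "(n, a) \<noteq> (8, 3)"
  shows "vertex_forwarding_index (complement (circulant n {1, a})) = 4"
proof -
  have a: "2 * a < n"
    using assms(3) by linarith
  let ?D = "circulant_differences n {1, a}"
  have D: "?D = {1, a, n - 1, n - a}"
    using assms(2) a by (rule circulant_differences_pair)
  have S: "{1, a} \<subseteq> {1..<n}"
    using assms(2) a by auto
  have card: "card ?D = 4"
    using assms(2) a by (simp add: D)
  have "\<exists>s\<in>{0..<n} - insert 0 ?D. (d - s) mod n \<notin> insert 0 ?D" if d: "d \<in> ?D" for d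
  proof (cases "n = 8")
    case False
    with assms(1) have "2 * card ?D < nat n"
      by (simp add: card)
    then show ?thesis
      using circulant_differences_subset[OF S] d by (intro split_difference)
  next
    case True
    with assms a have "a = 2" by auto
    with True D have D8: "?D = {1, 2, 7, 6}" by simp
    \<comment> \<open>The only residues outside \<open>D \<union> {0}\<close> are 3, 4 and 5; modulo 8,
      \<open>1 = 4 + 5\<close>, \<open>2 = 5 + 5\<close>, \<open>7 = 4 + 3\<close> and \<open>6 = 3 + 3\<close>.\<close>
    have "(d - (if d = 2 then 5 else if d = 6 then 3 else 4)) mod 8 \<in> {3, 4, 5::int}"
      using d D8 by auto
    then show ?thesis
      unfolding D8 using True
      by (intro bexI[of _ "if d = 2 then 5 else if d = 6 then 3 else 4"]) auto
  qed
  then have "vertex_forwarding_index (complement (circulant n {1, a})) = card ?D"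
    using assms(1) S by (intro vertex_forwarding_index_complement_circulant) auto
  with card show ?thesis by simp
qed

end
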